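(* Let $i \geq 5$ be an integer. Suppose that for every $j$ with $5 \leq j \leq i$, the number $N_j$ is the smallest positive integer $\alpha_j$ satisfying $(c_j)^{\alpha_j} \in L_{j-1}$. Then $c_i c_0$ and $a_i a_0$ are primitive elements of $L_i$.
   Context: Conway's tower of finite fields of characteristic two: $c_{-1} = 1$, $L_{-1} = F_2(c_{-1}) = F_2$ (the field with 2 elements); for $i \geq -1$, $L_{i+1} = L_i(c_{i+1})$, where $c_{i+1}$ satisfies $c_{i+1}^2 + c_{i+1} + \prod_{j=-1}^{i} c_j = 0$. Each $L_{i+1}$ is a quadratic extension of $L_i$, so for $i\ge 0$ the multiplicative group $L_i^* = L_i\setminus\{0\}$ has $2^{2^{i+1}}-1$ elements. Put $a_k = \prod_{j=0}^{k} c_j$ for $k \geq 0$, and let $N_j = 2^{2^j}+1$ ($j \geq 0$) be the Fermat numbers. An element of $L_i$ is primitive if it generates the multiplicative group $L_i^*$. *)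

theory Defs
  imports "HOL-Algebra.Algebra"
begin

(* The fields L i live inside one ambient field R, in which the roots c i are chosen; R, the
   choice of the roots and hence the tower are arbitrary.  The sequences c and L are indexed by
   integers so that the index -1 is available; values at indices below -1 are irrelevant.
   In characteristic two, {\<zero>, \<one>} is the prime field.
   That each step is a quadratic extension follows from these assumptions. *)
locale conway_tower = field R for R (structure) +
  fixes c :: "int \<Rightarrow> 'a" and L :: "int \<Rightarrow> 'a set"
  assumes char_two: "\<one> \<oplus> \<one> = \<zero>"
    and c_closed: "\<And>i. i \<ge> -1 \<Longrightarrow> c i \<in> carrier R"
    and c_base: "c (-1) = \<one>"
    and L_base: "L (-1) = generate_field R (insert (c (-1)) {\<zero>, \<one>})"
    and c_step: "\<And>i. i \<ge> -1 \<Longrightarrow>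
      c (i + 1) [^] (2::nat) \<oplus> c (i + 1) \<oplus> (\<Otimes>j\<in>{-1..i}. c j) = \<zero>"
    and L_step: "\<And>i. i \<ge> -1 \<Longrightarrow> L (i + 1) = generate_field R (insert (c (i + 1)) (L i))"

definition conway_a :: "('a, 'b) ring_scheme \<Rightarrow> (int \<Rightarrow> 'a) \<Rightarrow> int \<Rightarrow> 'a" where
  "conway_a R c k = (\<Otimes>\<^bsub>R\<^esub>j\<in>{0..k}. c j)"

definition fermat :: "nat \<Rightarrow> nat" where
  "fermat j = 2 ^ 2 ^ j + 1"

definition smallest_positive :: "(nat \<Rightarrow> bool) \<Rightarrow> nat \<Rightarrow> bool" where
  "smallest_positive P n \<longleftrightarrow> 0 < n \<and> P n \<and> (\<forall>m. 0 < m \<and> P m \<longrightarrow> n \<le> m)"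

(* HOL-Algebra contains two identical copies of mult_of; the qualified one comes with the theory
   of finite multiplicative groups of fields. *)
definition primitive_element :: "('a, 'b) ring_scheme \<Rightarrow> 'a set \<Rightarrow> 'a \<Rightarrow> bool" where
  "primitive_element R K x \<longleftrightarrow>
     x \<in> K \<and>
     generate (Multiplicative_Group.mult_of (R\<lparr>carrier := K\<rparr>)) {x}
       = carrier (Multiplicative_Group.mult_of (R\<lparr>carrier := K\<rparr>))"

end

(* With q = 2^(2^j), the q-th power map sends c_j to c_j + 1 and fixes a_{j-1}.  Hence
   c_j^(N_j) = c_j (c_j + 1) = a_{j-1} and a_j^(N_j) = a_{j-1}^3.  An element y of L_j whose
   powers in L_{j-1} are exactly those with exponent divisible by N_j has order N_j times the
   order of y^(N_j), and N_0 ... N_j = 2^(2^(j+1)) - 1.  Descending in this way, c_i c_0 and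
   a_i a_0 lead at the bottom to c_0^s with s prime to 3, of order 3 = N_0: each step cubes the
   factor a_j and multiplies s by N_j, which is prime to 3 for j >= 1, and a_0^3 = 1.
   For 1 <= j <= 4 the condition on c_j holds because N_j is prime and c_j is not in L_{j-1}. *)
theory Submission
  imports Defs
begin

section \<open>Roots of unity and generators of the multiplicative group of a subfield\<close>

lemma (in field) card_roots_of_unity:
  assumes "0 < d"
  shows "finite {x \<in> carrier R. x [^] d = \<one>}" "card {x \<in> carrier R. x [^] d = \<one>} \<le> d"
proof -
  \<comment> \<open>Coefficient lists start with the leading term, so appending the constant term
    turns X^(d-1) into X^d - 1.\<close>
  define p where "p = monom \<one> (d - 1) @ [\<ominus> \<one>]"
  have p: "p \<in> carrier (poly_ring R)"
    unfolding p_def univ_poly_carrier[symmetric] polynomial_def monom_def by auto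
  have deg: "degree p = d"
    using assms by (simp add: p_def monom_def)
  have eval: "eval p x = x [^] d \<ominus> \<one>" if "x \<in> carrier R" for x
  proof -
    have "eval p x = eval (monom \<one> (d - 1)) x \<otimes> x \<oplus> \<ominus> \<one>"
      unfolding p_def using that by (intro eval_append_aux monom_in_carrier) auto
    also have "eval (monom \<one> (d - 1)) x \<otimes> x = x [^] Suc (d - 1)"
      using that by (simp add: eval_monom)
    finally show ?thesis using assms by (simp add: a_minus_def)
  qed
  have sub: "{x \<in> carrier R. x [^] d = \<one>} \<subseteq> set_mset (roots p)"
    using p eval by (auto simp: roots_mem_iff_is_root is_root_def p_def)
  then show "finite {x \<in> carrier R. x [^] d = \<one>}"
    by (rule finite_subset) simp
  have "card {x \<in> carrier R. x [^] d = \<one>} \<le> card (set_mset (roots p))"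
    using sub by (rule card_mono[rotated]) simp
  also have "\<dots> \<le> size (roots p)"
    using size_mset_mono[OF mset_set_set_mset_msubset[of "roots p"]] by simp
  also have "\<dots> \<le> d"
    using size_roots_le_degree[OF p] deg by simp
  finally show "card {x \<in> carrier R. x [^] d = \<one>} \<le> d" .
qed

text \<open>Replaces a count of \<open>K\<close>: the exponent \<open>d\<close> places its nonzero
  elements among at most \<open>d\<close> roots of unity, while \<open>x\<close> already has at
  least \<open>d\<close> distinct powers.\<close>

lemma (in field) primitive_elementI:
  assumes K: "subfield K R" and x: "x \<in> K" "x \<noteq> \<zero>" and "0 < d"
    and exponent: "\<And>y. y \<in> K \<Longrightarrow> y \<noteq> \<zero> \<Longrightarrow> y [^] d = \<one>"
    and order: "\<And>m::nat. x [^] m = \<one> \<Longrightarrow> d dvd m"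
  shows "primitive_element R K x"
proof -
  let ?G = "Multiplicative_Group.mult_of (R\<lparr>carrier := K\<rparr>)"
  interpret G: group ?G
    using field.field_mult_group[OF subfield_iff(2)[OF K]] .
  have car: "carrier ?G = K - {\<zero>}" by simp
  have pow: "y [^]\<^bsub>?G\<^esub> m = y [^] m" for y and m :: nat
    by (induction m) (simp_all add: nat_pow_def)
  have sub: "carrier ?G \<subseteq> {y \<in> carrier R. y [^] d = \<one>}"
    using exponent subfieldE(3)[OF K] by auto
  then have fin: "finite (carrier ?G)"
    by (rule finite_subset) (rule card_roots_of_unity(1)[OF \<open>0 < d\<close>])
  have le: "card (carrier ?G) \<le> d"
    using card_mono[OF card_roots_of_unity(1)[OF \<open>0 < d\<close>] sub] card_roots_of_unity(2)[OF \<open>0 < d\<close>]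
    by simp
  have xG: "x \<in> carrier ?G" using x by simp
  have "x [^] G.ord x = \<one>"
    using G.pow_ord_eq_1[OF xG] pow by simp
  then have "d dvd G.ord x" by (rule order)
  moreover have "0 < G.ord x"
    using G.ord_ge_1[OF fin xG] by simp
  ultimately have "d \<le> card (generate ?G {x})"
    using G.generate_pow_card[OF xG] by (simp add: dvd_imp_le)
  then have "generate ?G {x} = carrier ?G"
    using fin le G.generate_incl[of "{x}"] xG by (intro card_seteq) auto
  then show ?thesis
    using x by (simp add: primitive_element_def)
qed

lemma (in field) pow_nonzero:
  "x \<in> carrier R \<Longrightarrow> x \<noteq> \<zero> \<Longrightarrow> x [^] (n::nat) \<noteq> \<zero>"
  by (induction n) (auto simp: integral_iff)

lemma (in field) subfield_pow_closed:
  assumes "subfield K R" "x \<in> K"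
  shows "x [^] (n::nat) \<in> K"
  using assms subringE(3,6)[OF subfieldE(1)[OF assms(1)]] by (induction n) auto

text \<open>Bezout writes the gcd as a difference of multiples of \<open>m\<close> and
  \<open>n\<close>, and a subfield allows division.\<close>

lemma (in field) subfield_pow_gcd:
  assumes K: "subfield K R" and x: "x \<in> carrier R" "x \<noteq> \<zero>"
    and m: "x [^] (m::nat) \<in> K" and n: "x [^] (n::nat) \<in> K"
  shows "x [^] gcd m n \<in> K"
proof (cases "m = 0")
  case True
  then show ?thesis using n by simp
next
  case False
  then obtain u v where uv: "m * u = n * v + gcd m n"
    using bezout_nat by blast
  have "x [^] (n * v) \<in> K - {\<zero>}"
    using subfield_pow_closed[OF K n, of v] x pow_nonzero by (simp add: nat_pow_pow)
  moreover have "x [^] (n * v) \<otimes> x [^] gcd m n \<in> K"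
    using subfield_pow_closed[OF K m, of u] x by (simp add: nat_pow_pow nat_pow_mult uv)
  ultimately show ?thesis
    using subfield_m_inv_simprule[OF K] x by blast
qed

section \<open>Arithmetic of the Fermat numbers\<close>

text \<open>Trial division up to 256 suffices because 65537 < 257 * 257.\<close>

lemma prime_65537: "Factorial_Ring.prime (65537::nat)"
proof -
  have small: "\<not> d dvd 65537" if "2 \<le> d" "d \<le> 256" for d :: nat
  proof -
    have "d \<in> {2..<257}" using that by simp
    then have "d \<in> set [2..<257]" by (simp only: set_upt)
    moreover have "list_all (\<lambda>d. \<not> d dvd (65537::nat)) [2..<257]"
      by (simp add: upt_conv_Cons_Cons del: upt.simps)
    ultimately show ?thesis unfolding list_all_iff by (rule bspec[rotated])
  qed
  show ?thesis
    unfolding prime_nat_iff'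
  proof safe
    fix n :: nat assume n: "n \<in> {2..<65537}" "n dvd 65537"
    then obtain m where m: "65537 = n * m" by blast
    have "256 < n" using small[of n] n by (simp add: not_le[symmetric]) blast
    moreover have "m \<noteq> 0" using m by (metis mult_0_right zero_neq_numeral)
    moreover have "m \<noteq> 1" using m n by (metis atLeastLessThan_iff less_irrefl nat_mult_1_right)
    moreover have "m dvd 65537" unfolding m by (rule dvd_triv_right)
    with small[of m] have "\<not> (2 \<le> m \<and> m \<le> 256)" by blast
    ultimately have "257 \<le> n" "257 \<le> m" by linarith+
    then have "257 * 257 \<le> n * m" by (rule mult_le_mono)
    then show False unfolding m[symmetric] by simp
  qed simp
qed

text \<open>Covers the levels below the range of the minimality hypothesis. The next number,
  \<open>fermat 5\<close> = 641 * 6700417, is composite.\<close>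

lemma prime_fermat:
  assumes "1 \<le> j" "j < 5"
  shows "Factorial_Ring.prime (fermat j)"
proof -
  have "j = 1 \<or> j = 2 \<or> j = 3 \<or> j = 4" using assms by auto
  moreover have "fermat 1 = 5" "fermat 2 = 17" "fermat 3 = 257" "fermat 4 = 65537"
    by (simp_all add: fermat_def)
  moreover have "Factorial_Ring.prime (5::nat)" "Factorial_Ring.prime (17::nat)"
      "Factorial_Ring.prime (257::nat)"
    by simp_all
  ultimately show ?thesis using prime_65537 by metis
qed

text \<open>For \<open>j \<ge> 1\<close> the power 2^(2^j) is a power of 4, hence 1 modulo
  3.\<close>

lemma not_3_dvd_fermat:
  assumes "1 \<le> j"
  shows "\<not> 3 dvd fermat j"
proof -
  obtain i where i: "j = Suc i" using assms by (cases j) auto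
  have "(2::nat) ^ 2 ^ j = 4 ^ 2 ^ i"
    by (simp add: i power_mult)
  moreover have "(4::nat) ^ n mod 3 = 1" for n
    using power_mod[of "4::nat" 3 n] by simp
  ultimately have "2 ^ 2 ^ j mod 3 = (1::nat)" by metis
  then show ?thesis unfolding fermat_def by presburger
qed

text \<open>A difference of squares; it accumulates the factors \<open>fermat j\<close> into the
  group order during the descent.\<close>

lemma fermat_telescope: "fermat j * (2 ^ 2 ^ j - 1) = 2 ^ 2 ^ Suc j - 1"
proof -
  define x :: nat where "x = 2 ^ 2 ^ j"
  have "2 ^ 2 ^ Suc j = x * x"
    by (simp add: x_def mult_2 power_add)
  moreover have "(x + 1) * (x - 1) = x * x - 1"
    by (cases x) simp_all
  ultimately show ?thesis by (simp add: fermat_def x_def)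
qed

section \<open>The tower indexed by naturals, and arithmetic in characteristic two\<close>

context conway_tower
begin

definition \<gamma> :: "nat \<Rightarrow> 'a" where "\<gamma> j = c (int j)"

text \<open>The next two are shifted by one: \<open>K j\<close> is \<open>L\<^sub>j\<^sub>-\<^sub>1\<close>, of order \<open>2 ^ 2 ^ j\<close>, and \<open>\<pi> j\<close> is
  \<open>a\<^sub>j\<^sub>-\<^sub>1\<close>, so that \<open>\<gamma> j\<close> is a root of \<open>X\<^sup>2 + X + \<pi> j\<close> over \<open>K j\<close>.\<close>

definition K :: "nat \<Rightarrow> 'a set" where "K j = L (int j - 1)"

definition \<pi> :: "nat \<Rightarrow> 'a" where "\<pi> j = conway_a R c (int j - 1)"

lemma add_self: "x \<in> carrier R \<Longrightarrow> x \<oplus> x = \<zero>"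
  by (metis char_two l_distr l_null l_one one_closed)

lemma minus_eq_self: "x \<in> carrier R \<Longrightarrow> \<ominus> x = x"
  using add_self minus_equality by blast

lemma add_self_left: "x \<in> carrier R \<Longrightarrow> y \<in> carrier R \<Longrightarrow> x \<oplus> (x \<oplus> y) = y"
  by (metis add_self a_assoc l_zero)

lemma square_add:
  assumes "x \<in> carrier R" "y \<in> carrier R"
  shows "(x \<oplus> y) [^] (2::nat) = x [^] (2::nat) \<oplus> y [^] (2::nat)"
  using assms by (simp add: numeral_2_eq_2 l_distr r_distr m_comm[of y x] a_assoc add_self_left)

lemma frobenius_add:
  assumes "x \<in> carrier R" "y \<in> carrier R"
  shows "(x \<oplus> y) [^] (2 ^ n :: nat) = x [^] (2 ^ n :: nat) \<oplus> y [^] (2 ^ n :: nat)"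
proof (induction n)
  case 0
  then show ?case using assms by simp
next
  case (Suc n)
  have "z [^] (2 ^ Suc n :: nat) = (z [^] (2 ^ n :: nat)) [^] (2::nat)" if "z \<in> carrier R" for z
    using that by (simp add: nat_pow_pow mult.commute)
  then show ?case using assms Suc by (simp add: square_add)
qed

text \<open>The fixed points of a field endomorphism form a subfield, so checking generators is
  enough.\<close>

lemma generate_field_frobenius_fixed:
  assumes H: "H \<subseteq> carrier R" "\<And>h. h \<in> H \<Longrightarrow> h [^] (2 ^ n :: nat) = h"
    and x: "x \<in> generate_field R H"
  shows "x [^] (2 ^ n :: nat) = x"
  using x
proof (induction rule: generate_field.induct)
  case (a_inv h)
  then show ?case using generate_field_in_carrier[OF H(1)] by (simp add: minus_eq_self)
next
  case (m_inv h)
  let ?N = "2 ^ n :: nat"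
  have h: "h \<in> carrier R" "h \<in> Units R"
    using m_inv generate_field_in_carrier[OF H(1)] by (auto simp: field_Units)
  \<comment> \<open>As \<open>h\<close> is fixed, the power of \<open>inv h\<close> is again an
    inverse of \<open>h\<close>, and inverses are unique.\<close>
  have "h \<otimes> inv h [^] ?N = (h \<otimes> inv h) [^] ?N"
    using h m_inv.IH nat_pow_distrib[of h "inv h" ?N] by (simp del: Units_r_inv)
  then have "h \<otimes> inv h [^] ?N = \<one>"
    using h by simp
  then show ?case
    using h comm_inv_char[of h "inv h [^] ?N"] by simp
next
  case (eng_add h1 h2)
  then show ?case using generate_field_in_carrier[OF H(1)] by (simp add: frobenius_add)
next
  case (eng_mult h1 h2)
  then show ?case using generate_field_in_carrier[OF H(1)] by (simp add: nat_pow_distrib)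
qed (auto simp: H)

section \<open>Basic properties of the generators, their products and the subfields\<close>

lemma c_carrier [simp]: "\<gamma> j \<in> carrier R"
  by (simp add: \<gamma>_def c_closed)

lemma pi_carrier [simp]: "\<pi> j \<in> carrier R"
  unfolding \<pi>_def conway_a_def by (rule finprod_closed) (auto intro: c_closed)

lemma pi_0 [simp]: "\<pi> 0 = \<one>"
  by (simp add: \<pi>_def conway_a_def)

lemma pi_Suc: "\<pi> (Suc j) = \<gamma> j \<otimes> \<pi> j"
proof -
  have "{0..int (Suc j) - 1} = insert (int j) {0..int j - 1}" by auto
  then show ?thesis unfolding \<pi>_def \<gamma>_def conway_a_def by (simp add: Pi_def c_closed)
qed

lemma c_equation: "\<gamma> j [^] (2::nat) \<oplus> \<gamma> j = \<pi> j"
proof -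
  \<comment> \<open>The extra factor at index -1 is 1, so the constant term of the quadratic is
    \<open>\<pi> j\<close>.\<close>
  have "{-1..int j - 1} = insert (-1) {0..int j - 1}" by auto
  then have "(\<Otimes>j\<in>{-1..int j - 1}. c j) = \<pi> j"
    unfolding \<pi>_def conway_a_def by (simp add: Pi_def c_closed c_base)
  then have "\<gamma> j [^] (2::nat) \<oplus> \<gamma> j \<oplus> \<pi> j = \<zero>"
    using c_step[of "int j - 1"] by (simp add: \<gamma>_def)
  then show ?thesis
    by (metis pi_carrier c_carrier a_closed nat_pow_closed minus_equality minus_eq_self)
qed

lemma K_0: "K 0 = generate_field R {\<zero>, \<one>}"
  using L_base c_base by (simp add: K_def insert_absorb)

lemma K_Suc: "K (Suc j) = generate_field R (insert (\<gamma> j) (K j))"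
  using L_step[of "int j - 1"] by (simp add: K_def \<gamma>_def)

lemma K_carrier: "K j \<subseteq> carrier R"
proof (induction j)
  case 0
  show ?case unfolding K_0 by (rule generate_field_incl) auto
next
  case (Suc j)
  then show ?case unfolding K_Suc by (intro generate_field_incl) auto
qed

lemma K_subfield: "subfield (K j) R"
proof (cases j)
  case 0
  then show ?thesis using generate_field_is_subfield[of "{\<zero>, \<one>}"] by (simp add: K_0)
next
  case (Suc i)
  then show ?thesis
    using K_Suc[of i] K_carrier[of i] generate_field_is_subfield[of "insert (\<gamma> i) (K i)"] by simp
qed

lemma K_Suc_mono: "K j \<subseteq> K (Suc j)"
  unfolding K_Suc by (auto intro: generate_field.incl)

lemma c_in_K: "\<gamma> j \<in> K (Suc j)"
  unfolding K_Suc by (auto intro: generate_field.incl)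

lemma K_mono: "i \<le> j \<Longrightarrow> K i \<subseteq> K j"
  by (rule lift_Suc_mono_le[of K]) (use K_Suc_mono in auto)

lemma pi_in_K: "\<pi> j \<in> K j"
proof (induction j)
  case 0
  then show ?case using subringE(3)[OF subfieldE(1)[OF K_subfield[of 0]]] by simp
next
  case (Suc j)
  then have "\<pi> j \<in> K (Suc j)" using K_Suc_mono by blast
  then show ?case
    unfolding pi_Suc using c_in_K subringE(6)[OF subfieldE(1)[OF K_subfield[of "Suc j"]]] by simp
qed

section \<open>The action of Frobenius on the tower\<close>

text \<open>Squaring is additive, so the difference \<open>z\<close> of two solutions satisfies z(z
  + 1) = 0.\<close>

lemma artin_schreier_roots:
  assumes "x \<in> carrier R" "y \<in> carrier R"
    and "x [^] (2::nat) \<oplus> x = y [^] (2::nat) \<oplus> y"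
  shows "x = y \<or> x = y \<oplus> \<one>"
proof -
  define z where "z = x \<oplus> y"
  have z: "z \<in> carrier R" using assms by (simp add: z_def)
  have x: "x = y \<oplus> z" using assms by (simp add: z_def a_comm[of x] add_self_left)
  have "y [^] (2::nat) \<oplus> y \<oplus> (z [^] (2::nat) \<oplus> z) = y [^] (2::nat) \<oplus> y \<oplus> \<zero>"
    using assms(2,3) z by (simp add: x square_add a_ac)
  then have "z [^] (2::nat) \<oplus> z = \<zero>"
    using assms z by simp
  then have "z \<otimes> (z \<oplus> \<one>) = \<zero>"
    using z by (simp add: numeral_2_eq_2 r_distr)
  then have "z = \<zero> \<or> z \<oplus> \<one> = \<zero>"
    using z integral by auto
  then have "z = \<zero> \<or> z = \<one>"
    using z by (metis minus_equality minus_eq_self one_closed)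
  then show ?thesis using x assms by auto
qed

text \<open>Instead of computing traces: with \<open>q = 2 ^ 2 ^ j\<close> and \<open>x = \<gamma> (Suc j)\<close>, the element \<open>d = x ^ q + x\<close> is a
  root of the equation of \<open>\<gamma> j\<close>, so that \<open>d ^ q = d + 1\<close>, which says \<open>x ^ (q * q) = x + 1\<close>.\<close>

lemma frobenius_c_pi: "\<gamma> j [^] (2 ^ 2 ^ j :: nat) = \<gamma> j \<oplus> \<one> \<and> \<pi> j [^] (2 ^ 2 ^ j :: nat) = \<pi> j"
proof (induction j)
  case 0
  have "\<gamma> 0 [^] (2::nat) = \<gamma> 0 \<oplus> \<one>"
    using c_equation[of 0] by (metis pi_0 a_comm add_self_left c_carrier nat_pow_closed)
  then show ?case by simp
next
  case (Suc j)
  define q :: nat where "q = 2 ^ 2 ^ j"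
  define x where "x = \<gamma> (Suc j)"
  define d where "d = x [^] q \<oplus> x"
  have carr: "x \<in> carrier R" "d \<in> carrier R" by (simp_all add: x_def d_def)
  have qadd: "(u \<oplus> v) [^] q = u [^] q \<oplus> v [^] q" if "u \<in> carrier R" "v \<in> carrier R" for u v
    unfolding q_def using that by (rule frobenius_add)
  have qq: "u [^] (2 ^ 2 ^ Suc j :: nat) = (u [^] q) [^] q" if "u \<in> carrier R" for u
    using that by (simp add: q_def nat_pow_pow mult_2 power_add)
  have c: "\<gamma> j [^] q = \<gamma> j \<oplus> \<one>" and b: "\<pi> j [^] q = \<pi> j"
    using Suc by (simp_all add: q_def)
  \<comment> \<open>The power \<open>q\<close> turns the factor \<open>\<gamma> j\<close> into
    \<open>\<gamma> j \<oplus> \<one>\<close>; a second application cancels the added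
    \<open>\<pi> j\<close>.\<close>
  have b_q: "\<pi> (Suc j) [^] q = \<pi> (Suc j) \<oplus> \<pi> j"
    by (simp only: pi_Suc) (simp add: nat_pow_distrib c b l_distr)
  have "(\<pi> (Suc j) [^] q) [^] q = \<pi> (Suc j)"
    by (simp only: b_q) (simp add: qadd b_q b a_assoc add_self)
  then have b': "\<pi> (Suc j) [^] (2 ^ 2 ^ Suc j :: nat) = \<pi> (Suc j)"
    using qq[OF pi_carrier] by simp
  \<comment> \<open>Both squaring and the power \<open>q\<close> are additive, so the map u -> u^2 +
    u commutes with u -> u^q + u.\<close>
  have "d [^] (2::nat) \<oplus> d = (x [^] (2::nat) \<oplus> x) [^] q \<oplus> (x [^] (2::nat) \<oplus> x)"
    using carr by (simp add: d_def square_add qadd nat_pow_pow mult.commute a_ac)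
  also have "\<dots> = \<pi> j"
    using c_equation[of "Suc j"] unfolding x_def
    by (simp only: b_q) (metis a_comm add_self_left pi_carrier a_closed)
  finally have "d = \<gamma> j \<or> d = \<gamma> j \<oplus> \<one>"
    using c_equation[of j] carr by (intro artin_schreier_roots) auto
  then have "d [^] q = d \<oplus> \<one>"
    using qadd[of "\<gamma> j" \<one>] by (auto simp: c)
  moreover have "d [^] q = (x [^] q) [^] q \<oplus> x [^] q"
    using carr by (simp add: d_def qadd)
  ultimately have "(x [^] q) [^] q \<oplus> x [^] q = x [^] q \<oplus> (x \<oplus> \<one>)"
    using carr by (simp add: d_def a_assoc)
  then have "(x [^] q) [^] q = x \<oplus> \<one>"
    using carr by (metis a_comm a_closed add_self_left nat_pow_closed one_closed)
  then show ?case using b' qq[of x] carr by (simp add: x_def)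
qed

lemmas frobenius_c = frobenius_c_pi[THEN conjunct1]
  and frobenius_pi = frobenius_c_pi[THEN conjunct2]

text \<open>The product of the two conjugate roots, that is, the norm down to \<open>K j\<close>, is
  the constant term of their quadratic.\<close>

lemma c_pow_fermat: "\<gamma> j [^] fermat j = \<pi> j"
proof -
  have "\<gamma> j [^] fermat j = (\<gamma> j \<oplus> \<one>) \<otimes> \<gamma> j"
    by (simp add: fermat_def frobenius_c)
  also have "\<dots> = \<gamma> j [^] (2::nat) \<oplus> \<gamma> j"
    by (simp add: l_distr numeral_2_eq_2)
  finally show ?thesis by (simp add: c_equation)
qed

lemma pi_pow_fermat: "\<pi> j [^] fermat j = \<pi> j [^] (2::nat)"
proof -
  have "\<pi> j [^] fermat j = \<pi> j \<otimes> \<pi> j"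
    by (simp add: fermat_def frobenius_pi)
  then show ?thesis by (simp add: numeral_2_eq_2)
qed

text \<open>Two applications of the lower Frobenius add 1 to \<open>\<gamma> j\<close> twice. This
  yields the exponent of the multiplicative group without counting elements.\<close>

lemma K_frobenius: "x \<in> K j \<Longrightarrow> x [^] (2 ^ 2 ^ j :: nat) = x"
proof (induction j arbitrary: x)
  case 0
  have "x \<in> generate_field R {\<zero>, \<one>}" using 0 by (simp add: K_0)
  then have "x [^] (2 ^ 1 :: nat) = x"
    by (rule generate_field_frobenius_fixed[rotated 2]) (auto simp: nat_pow_zero)
  then show ?case by simp
next
  case (Suc j)
  have qq: "u [^] (2 ^ 2 ^ Suc j :: nat) = (u [^] (2 ^ 2 ^ j :: nat)) [^] (2 ^ 2 ^ j :: nat)"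
    if "u \<in> carrier R" for u
    using that by (simp add: nat_pow_pow mult_2 power_add)
  have "\<gamma> j [^] (2 ^ 2 ^ Suc j :: nat) = \<gamma> j"
    by (subst qq) (simp_all add: frobenius_c frobenius_add a_assoc char_two)
  moreover have "u [^] (2 ^ 2 ^ Suc j :: nat) = u" if "u \<in> K j" for u
    using that K_carrier[of j] by (subst qq) (auto simp: Suc.IH)
  ultimately have "h [^] (2 ^ 2 ^ Suc j :: nat) = h" if "h \<in> insert (\<gamma> j) (K j)" for h
    using that by blast
  moreover have "insert (\<gamma> j) (K j) \<subseteq> carrier R"
    using K_carrier[of j] by simp
  ultimately show ?case
    using generate_field_frobenius_fixed Suc.prems unfolding K_Suc by blast
qed

lemma K_exponent:
  assumes "x \<in> K j" "x \<noteq> \<zero>"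
  shows "x [^] (2 ^ 2 ^ j - 1 :: nat) = \<one>"
proof -
  have x: "x \<in> carrier R" using assms K_carrier by blast
  have "x [^] (2 ^ 2 ^ j - 1 :: nat) \<otimes> x = x [^] Suc (2 ^ 2 ^ j - 1)"
    by (rule nat_pow_Suc[symmetric])
  also have "\<dots> = \<one> \<otimes> x" using K_frobenius[OF assms(1)] x by simp
  finally show ?thesis
    using m_rcancel[OF assms(2) x nat_pow_closed[OF x] one_closed] by blast
qed

text \<open>Frobenius fixes \<open>K j\<close> but adds 1 to \<open>\<gamma> j\<close>.\<close>

lemma c_notin_K: "\<gamma> j \<notin> K j"
proof
  assume "\<gamma> j \<in> K j"
  then have "\<gamma> j \<oplus> \<one> = \<gamma> j \<oplus> \<zero>"
    using K_frobenius[of "\<gamma> j" j] frobenius_c[of j] by simp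
  then show False by (simp del: r_zero)
qed

lemma c_nonzero: "\<gamma> j \<noteq> \<zero>"
  using c_notin_K[of j] subringE(2)[OF subfieldE(1)[OF K_subfield[of j]]] by auto

lemma pi_nonzero: "\<pi> j \<noteq> \<zero>"
  by (induction j) (simp_all add: pi_Suc c_nonzero integral_iff)

section \<open>Orders of elements by descent through the tower\<close>

text \<open>The gcd of \<open>m\<close> and \<open>fermat j\<close> is again an exponent leading
  into \<open>K j\<close>. It equals \<open>fermat j\<close> by minimality for
  \<open>j \<ge> 5\<close>, and for smaller \<open>j\<close> because \<open>fermat j\<close> is
  prime and the gcd is not 1.\<close>

lemma relative_order_dvd:
  assumes "1 \<le> j"
    and "5 \<le> j \<Longrightarrow> smallest_positive (\<lambda>\<alpha>. \<gamma> j [^] \<alpha> \<in> K j) (fermat j)"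
    and m: "\<gamma> j [^] (m::nat) \<in> K j"
  shows "fermat j dvd m"
proof -
  define g where "g = gcd m (fermat j)"
  have "\<gamma> j [^] fermat j \<in> K j"
    by (simp add: c_pow_fermat pi_in_K)
  then have g: "\<gamma> j [^] g \<in> K j"
    unfolding g_def using m c_nonzero by (intro subfield_pow_gcd[OF K_subfield]) auto
  have "fermat j = g"
  proof (cases "5 \<le> j")
    case True
    have "0 < g" by (simp add: g_def fermat_def)
    then have "fermat j \<le> g"
      using assms(2)[OF True] g by (auto simp: smallest_positive_def)
    moreover have "g \<le> fermat j"
      unfolding g_def by (rule gcd_le2_nat) (simp add: fermat_def)
    ultimately show ?thesis by simp
  next
    case False
    have "g \<noteq> 1" using g c_notin_K[of j] by auto
    moreover have "g dvd fermat j" by (simp add: g_def)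
    ultimately show ?thesis
      using prime_fermat[of j] assms(1) False by (auto simp: prime_nat_iff)
  qed
  then show ?thesis by (metis g_def gcd_dvd1)
qed

text \<open>Bottom of the descent: \<open>\<gamma> 0\<close> is a primitive cube root of
  unity.\<close>

lemma c0_pow_eq_one:
  "\<gamma> 0 [^] m = \<one> \<longleftrightarrow> 3 dvd m" for m :: nat
proof -
  have two: "\<gamma> 0 [^] (2::nat) = \<gamma> 0 \<oplus> \<one>"
    using frobenius_c[of 0] by simp
  have three: "\<gamma> 0 [^] (3::nat) = \<one>"
    using c_pow_fermat[of 0] by (simp add: fermat_def)
  have "\<gamma> 0 [^] m = \<gamma> 0 [^] (m mod 3)"
  proof -
    have "\<gamma> 0 [^] m = \<gamma> 0 [^] (3 * (m div 3) + m mod 3)" by simp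
    also have "\<dots> = \<gamma> 0 [^] (3 * (m div 3)) \<otimes> \<gamma> 0 [^] (m mod 3)"
      by (rule nat_pow_mult[symmetric]) simp
    also have "\<gamma> 0 [^] (3 * (m div 3)) = \<one>"
      by (subst nat_pow_pow[symmetric]) (simp_all add: three)
    finally show ?thesis by simp
  qed
  moreover have "\<gamma> 0 \<noteq> \<one>"
    using c_notin_K[of 0] subringE(3)[OF subfieldE(1)[OF K_subfield[of 0]]] by auto
  moreover have "\<gamma> 0 [^] (2::nat) \<noteq> \<one>"
    using two c_nonzero[of 0] by (metis add_self_left c_carrier a_comm one_closed r_zero char_two)
  moreover have "m mod 3 = 0 \<or> m mod 3 = 1 \<or> m mod 3 = 2" by auto
  ultimately show ?thesis
    by (auto simp: dvd_eq_mod_eq_0)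
qed

text \<open>Dividing by the power of \<open>z\<close> inside \<open>K j\<close> leaves a power of
  \<open>\<gamma> j\<close> there; coprimality then removes \<open>r\<close> from the
  exponent.\<close>

lemma fermat_dvd_of_pow:
  assumes "1 \<le> j"
    and "5 \<le> j \<Longrightarrow> smallest_positive (\<lambda>\<alpha>. \<gamma> j [^] \<alpha> \<in> K j) (fermat j)"
    and z: "z \<in> K j" "z \<noteq> \<zero>" and m: "(\<gamma> j [^] (r::nat) \<otimes> z) [^] (m::nat) = \<one>"
    and r: "coprime (fermat j) r"
  shows "fermat j dvd m"
proof -
  have zc: "z \<in> carrier R" using z K_carrier by blast
  have "z [^] m \<otimes> \<gamma> j [^] (r * m) = \<one>"
    using m zc by (simp add: nat_pow_distrib nat_pow_pow m_comm)
  moreover have "z [^] m \<in> K j - {\<zero>}"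
    using subfield_pow_closed[OF K_subfield z(1)] pow_nonzero[OF zc z(2)] by simp
  moreover have "\<one> \<in> K j"
    by (rule subringE(3)[OF subfieldE(1)[OF K_subfield]])
  ultimately have "\<gamma> j [^] (r * m) \<in> K j"
    using subfield_m_inv_simprule[OF K_subfield] by (metis c_carrier nat_pow_closed)
  then have "fermat j dvd r * m"
    using assms(1,2) by (intro relative_order_dvd)
  then show ?thesis
    using r by (simp add: coprime_dvd_mult_right_iff)
qed

text \<open>The extra exponents \<open>k\<close> and \<open>s\<close> make the statement stable under the induction: the
  power \<open>fermat n\<close> of \<open>a\<^sub>n ^ (3 ^ k) * c\<^sub>0 ^ s\<close> has the same shape one level lower, with
  \<open>k + 1\<close> and \<open>s * fermat n\<close>.\<close>

lemma order_dvd: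
  assumes "\<And>j. 5 \<le> j \<Longrightarrow> j \<le> n \<Longrightarrow> smallest_positive (\<lambda>\<alpha>. \<gamma> j [^] \<alpha> \<in> K j) (fermat j)"
    and "1 \<le> n + k" "\<not> 3 dvd s"
    and "(\<pi> (Suc n) [^] (3 ^ k :: nat) \<otimes> \<gamma> 0 [^] (s::nat)) [^] (m::nat) = \<one>"
  shows "2 ^ 2 ^ Suc n - 1 dvd m"
  using assms
proof (induction n arbitrary: k s m)
  case 0
  have b1: "\<pi> (Suc 0) = \<gamma> 0" using pi_Suc[of 0] by simp
  \<comment> \<open>Here \<open>1 \<le> n + k\<close> forces \<open>k \<ge> 1\<close>, so the
    exponent is a multiple of 3.\<close>
  have "\<gamma> 0 [^] (3 ^ k :: nat) = \<one>"
    using 0 by (subst c0_pow_eq_one) (simp add: dvd_power)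
  then have "\<gamma> 0 [^] (s * m) = \<one>"
    using 0(4) unfolding b1 by (simp add: nat_pow_pow)
  then have "3 dvd s * m" by (simp only: c0_pow_eq_one)
  then have "3 dvd m" using 0(3) prime_dvd_mult_nat[of 3 s m] by simp
  then show ?case by simp
next
  case (Suc n)
  define j where "j = Suc n"
  let ?y = "\<pi> (Suc j) [^] (3 ^ k :: nat) \<otimes> \<gamma> 0 [^] s"
  have j: "1 \<le> j" by (simp add: j_def)
  have nd: "\<not> 3 dvd fermat j" by (rule not_3_dvd_fermat[OF j])
  have cop: "coprime (fermat j) (3 ^ k)"
    using nd prime_imp_coprime_nat[of 3 "fermat j"] by (simp add: coprime_commute)
  \<comment> \<open>\<open>?z\<close> collects everything except the power of the top generator
    \<open>\<gamma> j\<close>, hence lies in \<open>K j\<close>.\<close>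
  let ?z = "\<pi> j [^] (3 ^ k :: nat) \<otimes> \<gamma> 0 [^] s"
  have y: "?y = \<gamma> j [^] (3 ^ k :: nat) \<otimes> ?z"
    by (simp only: pi_Suc) (simp add: nat_pow_distrib m_assoc)
  have "\<gamma> 0 \<in> K j" using c_in_K[of 0] K_mono[of "Suc 0" j] j by auto
  then have zK: "?z \<in> K j"
    using subringE(6)[OF subfieldE(1)[OF K_subfield]] subfield_pow_closed[OF K_subfield] pi_in_K
    by blast
  have z0: "?z \<noteq> \<zero>"
    using pow_nonzero pi_nonzero c_nonzero[of 0] by (simp add: integral_iff)
  have "fermat j dvd m"
    using Suc.prems(4) j_def y
    by (intro fermat_dvd_of_pow[OF j _ zK z0 _ cop]) (auto intro: Suc.prems(1))
  then obtain m' where m': "m = fermat j * m'" by blast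
  \<comment> \<open>The factor \<open>\<gamma> j\<close> contributes \<open>\<pi> j\<close> and the
    factor \<open>\<pi> j\<close> contributes its square.\<close>
  have bF: "\<pi> (Suc j) [^] fermat j = \<pi> j [^] (3::nat)"
    by (simp only: pi_Suc) (simp add: nat_pow_distrib c_pow_fermat pi_pow_fermat numeral_2_eq_2 numeral_3_eq_3 m_ac)
  have "?y [^] fermat j = (\<pi> (Suc j) [^] fermat j) [^] (3 ^ k :: nat) \<otimes> \<gamma> 0 [^] (s * fermat j)"
    by (simp add: nat_pow_distrib nat_pow_pow mult.commute)
  also have "\<dots> = \<pi> j [^] (3 ^ Suc k :: nat) \<otimes> \<gamma> 0 [^] (s * fermat j)"
    by (simp only: bF) (simp add: nat_pow_pow)
  finally have "(\<pi> (Suc n) [^] (3 ^ Suc k :: nat) \<otimes> \<gamma> 0 [^] (s * fermat j)) [^] m' = \<one>"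
    using Suc.prems(4) unfolding m' j_def[symmetric] by (simp add: nat_pow_pow[symmetric])
  moreover have "\<not> 3 dvd s * fermat j"
    using nd Suc.prems(3) prime_dvd_mult_nat[of 3 s "fermat j"] by simp
  ultimately have "2 ^ 2 ^ Suc n - 1 dvd m'"
    using Suc.prems(1) by (intro Suc.IH[of "Suc k" "s * fermat j"]) auto
  then have "fermat j * (2 ^ 2 ^ j - 1) dvd m"
    unfolding m' j_def by (rule mult_dvd_mono[OF dvd_refl])
  then show ?case unfolding fermat_telescope j_def .
qed

lemma primitive_elements:
  assumes n: "2 \<le> n"
    and hyp: "\<And>j. 5 \<le> j \<Longrightarrow> j \<le> n \<Longrightarrow>
      smallest_positive (\<lambda>\<alpha>. \<gamma> j [^] \<alpha> \<in> K j) (fermat j)"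
  shows "primitive_element R (K (Suc n)) (\<gamma> n \<otimes> \<gamma> 0)"
    and "primitive_element R (K (Suc n)) (\<pi> (Suc n) \<otimes> \<gamma> 0)"
proof -
  note closed = subringE(6)[OF subfieldE(1)[OF K_subfield]]
  have c0: "\<gamma> 0 \<in> K j" if "1 \<le> j" for j
    using c_in_K[of 0] K_mono[of "Suc 0" j] that by auto
  have pos: "0 < (2 ^ 2 ^ Suc n - 1 :: nat)"
    using one_less_power[of "2::nat" "2 ^ Suc n"] by simp
  show "primitive_element R (K (Suc n)) (\<gamma> n \<otimes> \<gamma> 0)"
  proof (rule primitive_elementI[OF K_subfield _ _ pos K_exponent])
    show "\<gamma> n \<otimes> \<gamma> 0 \<in> K (Suc n)" using closed c_in_K c0 by auto
    show "\<gamma> n \<otimes> \<gamma> 0 \<noteq> \<zero>" using c_nonzero[of n] c_nonzero[of 0] by (simp add: integral_iff)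
    fix m :: nat assume m: "(\<gamma> n \<otimes> \<gamma> 0) [^] m = \<one>"
    then have "(\<gamma> n [^] (1::nat) \<otimes> \<gamma> 0) [^] m = \<one>" by simp
    \<comment> \<open>Only \<open>\<gamma> n\<close> occurs here instead of a full product, so the
      first descent step is done separately; its result has the shape required by
      \<open>order_dvd\<close>.\<close>
    then have "fermat n dvd m"
      using n hyp c0 c_nonzero[of 0] by (intro fermat_dvd_of_pow[where r = 1]) auto
    then obtain m' where m': "m = fermat n * m'" by blast
    \<comment> \<open>\<open>2 \<le> n\<close> gives \<open>1 \<le> i\<close>, the condition of
      \<open>order_dvd\<close> when \<open>k\<close> is 0.\<close>
    obtain i where i: "n = Suc i" "1 \<le> i" using n by (cases n) auto
    have "(\<gamma> n \<otimes> \<gamma> 0) [^] fermat n = \<pi> n [^] (3 ^ 0 :: nat) \<otimes> \<gamma> 0 [^] fermat n"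
      by (simp add: nat_pow_distrib c_pow_fermat)
    then have "(\<pi> (Suc i) [^] (3 ^ 0 :: nat) \<otimes> \<gamma> 0 [^] fermat n) [^] m' = \<one>"
      using m unfolding m' i(1) by (simp add: nat_pow_pow[symmetric])
    then have "2 ^ 2 ^ Suc i - 1 dvd m'"
      using hyp i n not_3_dvd_fermat[of n] by (intro order_dvd[of i 0 "fermat n"]) auto
    then have "fermat n * (2 ^ 2 ^ n - 1) dvd m"
      unfolding m' i(1) by (rule mult_dvd_mono[OF dvd_refl])
    then show "2 ^ 2 ^ Suc n - 1 dvd m" unfolding fermat_telescope .
  qed
  show "primitive_element R (K (Suc n)) (\<pi> (Suc n) \<otimes> \<gamma> 0)"
  proof (rule primitive_elementI[OF K_subfield _ _ pos K_exponent])
    show "\<pi> (Suc n) \<otimes> \<gamma> 0 \<in> K (Suc n)" using closed pi_in_K c0 by auto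
    show "\<pi> (Suc n) \<otimes> \<gamma> 0 \<noteq> \<zero>"
      using pi_nonzero[of "Suc n"] c_nonzero[of 0] pi_carrier[of "Suc n"] c_carrier[of 0] integral by blast
    fix m :: nat assume "(\<pi> (Suc n) \<otimes> \<gamma> 0) [^] m = \<one>"
    then have "(\<pi> (Suc n) [^] (3 ^ 0 :: nat) \<otimes> \<gamma> 0 [^] (1::nat)) [^] m = \<one>"
      using pi_carrier[of "Suc n"] by simp
    then show "2 ^ 2 ^ Suc n - 1 dvd m"
      using hyp n by (intro order_dvd[of n 0 1]) auto
  qed
qed

end

theorem corollary3:
  fixes R :: "('a, 'b) ring_scheme" (structure)
    and c :: "int \<Rightarrow> 'a" and L :: "int \<Rightarrow> 'a set" and i :: int
  assumes "conway_tower R c L"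
    and "i \<ge> 5"
    and "\<And>j. 5 \<le> j \<Longrightarrow> j \<le> i \<Longrightarrow>
           smallest_positive (\<lambda>\<alpha>. c j [^] \<alpha> \<in> L (j - 1)) (fermat (nat j))"
  shows "primitive_element R (L i) (c i \<otimes> c 0)
       \<and> primitive_element R (L i) (conway_a R c i \<otimes> conway_a R c 0)"
proof -
  interpret conway_tower R c L by fact
  define n where "n = nat i"
  have i: "i = int n" and n: "5 \<le> n"
    using assms(2) by (auto simp: n_def)
  have hyp: "smallest_positive (\<lambda>\<alpha>. \<gamma> j [^] \<alpha> \<in> K j) (fermat j)"
    if "5 \<le> j" "j \<le> n" for j
    using assms(3)[of "int j"] that i by (simp add: \<gamma>_def K_def)
  \<comment> \<open>By the index shift \<open>\<pi> 1\<close> is \<open>a\<^sub>0\<close>, so the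
    second claim has the form treated above.\<close>
  have "\<pi> 1 = \<gamma> 0"
    using pi_Suc[of 0] by simp
  then have "conway_a R c 0 = c 0"
    by (simp add: \<pi>_def \<gamma>_def)
  then show ?thesis
    using primitive_elements[of n] hyp n i by (simp add: \<gamma>_def K_def \<pi>_def)
qed

end
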